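(* Let $L$ be a Leibniz algebra over a field $F$. Then the subspace $\langle x^2 \mid x\in L\rangle$ (the linear span of the squares of elements of $L$) is a two-sided ideal of $L$.
   Context: A (left) Leibniz algebra is an algebra $L$ over a field $F$ with $a(bc)=(ab)c+b(ac)$ for all $a,b,c\in L$. No dimension assumption is made. *)

theory Defs
  imports Complex_Main
begin

text \<open>
  Algebras here need not be associative, unital or finite-dimensional: a vector space
  (the whole type \<^typ>\<open>'v\<close>) over a field \<^typ>\<open>'f\<close> with a bilinear product.
\<close>

locale nonassoc_algebra = vector_space scale
  for scale :: "'f::field \<Rightarrow> 'v::ab_group_add \<Rightarrow> 'v" +
  fixes mult :: "'v \<Rightarrow> 'v \<Rightarrow> 'v" (infixl \<open>\<bullet>\<close> 70)
  assumes linear_mult_left: "Vector_Spaces.linear scale scale (\<lambda>a. a \<bullet> b)"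
    and linear_mult_right: "Vector_Spaces.linear scale scale (\<lambda>b. a \<bullet> b)"
begin

definition two_sided_ideal :: "'v set \<Rightarrow> bool" where
  "two_sided_ideal I \<longleftrightarrow> subspace I \<and> (\<forall>a. \<forall>x\<in>I. a \<bullet> x \<in> I \<and> x \<bullet> a \<in> I)"

end

text \<open>
  Left Leibniz algebras: left multiplications are derivations.
\<close>

locale leibniz_algebra = nonassoc_algebra scale mult
  for scale :: "'f::field \<Rightarrow> 'v::ab_group_add \<Rightarrow> 'v"
    and mult :: "'v \<Rightarrow> 'v \<Rightarrow> 'v" (infixl \<open>\<bullet>\<close> 70) +
  assumes leibniz_identity: "a \<bullet> (b \<bullet> c) = (a \<bullet> b) \<bullet> c + b \<bullet> (a \<bullet> c)"

end

theory Submission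
  imports Defs
begin

text \<open>
  Taking \<open>a = b = x\<close> in the Leibniz identity gives \<open>x\<^sup>2 c = 0\<close>, so right multiplication
  annihilates the span of squares. On the left, \<open>a x\<^sup>2 = (a x) x + x (a x)\<close> is the
  polarization of the square at \<open>a x\<close> and \<open>x\<close>.
\<close>

context nonassoc_algebra
begin

lemma mult_add_left: "(a + b) \<bullet> c = a \<bullet> c + b \<bullet> c"
proof -
  interpret hom: Vector_Spaces.linear scale scale "\<lambda>d. d \<bullet> c"
    by (rule linear_mult_left)
  show ?thesis
    by (rule hom.add)
qed

lemma mult_add_right: "a \<bullet> (b + c) = a \<bullet> b + a \<bullet> c"
proof -
  interpret hom: Vector_Spaces.linear scale scale "\<lambda>d. a \<bullet> d"
    by (rule linear_mult_right)
  show ?thesis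
    by (rule hom.add)
qed

abbreviation squares :: "'v set" where
  "squares \<equiv> {x \<bullet> x | x. True}"

text \<open>Expanding the square of \<open>x + y\<close> and subtracting those of \<open>x\<close>
  and \<open>y\<close> leaves the mixed terms; nothing is divided by 2, so characteristic 2 is
  covered.\<close>

lemma anticommutator_in_span_squares: "x \<bullet> y + y \<bullet> x \<in> span squares"
proof -
  have "x \<bullet> y + y \<bullet> x = (x + y) \<bullet> (x + y) - x \<bullet> x - y \<bullet> y"
    by (simp add: mult_add_left mult_add_right)
  moreover have "z \<bullet> z \<in> span squares" for z
    by (rule span_base) blast
  ultimately show ?thesis
    by (simp add: span_diff)
qed

end

context leibniz_algebra
begin

text \<open>The term \<open>x \<bullet> (x \<bullet> c)\<close> stands on both sides of the identity
  and cancels.\<close>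

lemma square_mult: "(x \<bullet> x) \<bullet> c = 0"
  using leibniz_identity[of x x c] by simp

lemma span_squares_mult:
  assumes "x \<in> span squares"
  shows "x \<bullet> a = 0"
proof -
  interpret hom: Vector_Spaces.linear scale scale "\<lambda>b. b \<bullet> a"
    by (rule linear_mult_left)
  show ?thesis
    by (rule hom.eq_0_on_span[OF _ assms]) (auto simp: square_mult)
qed

lemma mult_span_squares:
  assumes "x \<in> span squares"
  shows "a \<bullet> x \<in> span squares"
proof -
  interpret hom: Vector_Spaces.linear scale scale "\<lambda>b. a \<bullet> b"
    by (rule linear_mult_right)
  \<comment> \<open>A linear map sends the span of a set to the span of its image, so checking the
    generators suffices.\<close>
  have "(\<lambda>b. a \<bullet> b) ` squares \<subseteq> span squares"
  proof clarify
    fix x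
    show "a \<bullet> (x \<bullet> x) \<in> span squares"
      unfolding leibniz_identity[of a x x] by (rule anticommutator_in_span_squares)
  qed
  then have "span ((\<lambda>b. a \<bullet> b) ` squares) \<subseteq> span squares"
    by (rule span_minimal) (rule subspace_span)
  then show ?thesis
    using assms by (auto simp: hom.span_image)
qed

lemma two_sided_ideal_span_squares: "two_sided_ideal (span squares)"
  \<comment> \<open>Products \<open>x \<bullet> a\<close> with \<open>x\<close> in the span are 0,
    so \<open>span_zero\<close> settles that side.\<close>
  using span_squares_mult mult_span_squares by (simp add: two_sided_ideal_def span_zero)

end

theorem lemma1p1:
  fixes scale :: "'f::field \<Rightarrow> 'v::ab_group_add \<Rightarrow> 'v"
    and mult :: "'v \<Rightarrow> 'v \<Rightarrow> 'v"
  assumes "leibniz_algebra scale mult"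
  shows "nonassoc_algebra.two_sided_ideal scale mult
           (module.span scale {mult x x | x. True})"
  using assms by (rule leibniz_algebra.two_sided_ideal_span_squares)

end
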